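(* Let $(X,\mu,m)$ be a connected weighted graph which admits a compatible intrinsic metric. Then, for $p\in(1,\infty)$, every non-negative subharmonic function in $L^p(X,m)$ is constant.
   Context: Weighted graph: $X$ is a countable discrete set, $m:X\to(0,\infty)$ is extended additively to a measure on all subsets of $X$, and $\mu:X\times X\to[0,\infty)$, $(x,y)\mapsto\mu_{xy}$, is symmetric, zero on the diagonal, and satisfies $\sum_{y\in X}\mu_{xy}<\infty$ for all $x\in X$ (local finiteness is not assumed). Write $x\sim y$ if $\mu_{xy}>0$. The graph is connected if any two vertices $x,y$ are joined by a path $x=x_0\sim x_1\sim\dots\sim x_n=y$. Subharmonic: let $F(X)=\{f:X\to\mathbb{R}\mid \sum_{y\in X}\mu_{xy}|f(y)|<\infty \text{ for all }x\in X\}$ and $\Delta f(x)=\frac1{m(x)}\sum_{y\in X}\mu_{xy}(f(x)-f(y))$ for $f\in F(X)$. A function $f:X\to\mathbb{R}$ is subharmonic if $f\in F(X)$ and $\Delta f\le 0$ pointwise. Compatible intrinsic metric: a pseudo metric is a symmetric map $\rho:X\times X\to[0,\infty)$ with zero diagonal satisfying the triangle inequality. It is intrinsic if $\sum_{y\in X}\mu_{xy}\rho^2(x,y)\le m(x)$ for all $x\in X$. Its jump size is $s=\sup\{\rho(x,y)\mid x\sim y\}$. The weighted vertex degree is $\mathrm{Deg}(x)=\frac1{m(x)}\sum_{y\in X}\mu_{xy}$. A pseudo metric is compatible if $s<\infty$ and $\mathrm{Deg}$ is bounded on each ball $B_r=\{x\mid\rho(x,o)\le r\}$, $r\ge0$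 ($o\in X$ a fixed vertex; the choice is immaterial). *)

theory Defs
  imports "HOL-Analysis.Analysis"
begin

text \<open>
  The countable discrete vertex set is the universe of a type of class \<open>countable\<close> (finite or
  countably infinite). All sums over vertices are unconditional sums over \<open>UNIV\<close>; since a
  non-summable \<open>infsum\<close> has value 0, finiteness of a sum is always stated as \<open>summable_on\<close>.
\<close>

locale weighted_graph =
  fixes \<mu> :: "'a::countable \<Rightarrow> 'a \<Rightarrow> real" and m :: "'a \<Rightarrow> real"
  assumes m_pos: "m x > 0"
    and \<mu>_nonneg: "\<mu> x y \<ge> 0"
    and \<mu>_sym: "\<mu> x y = \<mu> y x"
    and \<mu>_diag: "\<mu> x x = 0"
    and \<mu>_summable: "(\<lambda>y. \<mu> x y) summable_on UNIV"

definition adjacent :: "('a \<Rightarrow> 'a \<Rightarrow> real) \<Rightarrow> 'a \<Rightarrow> 'a \<Rightarrow> bool" where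
  "adjacent \<mu> x y \<longleftrightarrow> \<mu> x y > 0"

definition graph_connected :: "('a \<Rightarrow> 'a \<Rightarrow> real) \<Rightarrow> bool" where
  "graph_connected \<mu> \<longleftrightarrow> (\<forall>x y. (adjacent \<mu>)\<^sup>*\<^sup>* x y)"

definition F_space :: "('a \<Rightarrow> 'a \<Rightarrow> real) \<Rightarrow> ('a \<Rightarrow> real) set" where
  "F_space \<mu> = {f. \<forall>x. (\<lambda>y. \<mu> x y * \<bar>f y\<bar>) summable_on UNIV}"

definition laplacian :: "('a \<Rightarrow> 'a \<Rightarrow> real) \<Rightarrow> ('a \<Rightarrow> real) \<Rightarrow> ('a \<Rightarrow> real) \<Rightarrow> 'a \<Rightarrow> real" where
  "laplacian \<mu> m f x = 1 / m x * (\<Sum>\<^sub>\<infinity>y. \<mu> x y * (f x - f y))"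

definition subharmonic :: "('a \<Rightarrow> 'a \<Rightarrow> real) \<Rightarrow> ('a \<Rightarrow> real) \<Rightarrow> ('a \<Rightarrow> real) \<Rightarrow> bool" where
  "subharmonic \<mu> m f \<longleftrightarrow> f \<in> F_space \<mu> \<and> (\<forall>x. laplacian \<mu> m f x \<le> 0)"

definition pseudo_metric :: "('a \<Rightarrow> 'a \<Rightarrow> real) \<Rightarrow> bool" where
  "pseudo_metric \<rho> \<longleftrightarrow>
     (\<forall>x y. \<rho> x y \<ge> 0) \<and> (\<forall>x. \<rho> x x = 0) \<and> (\<forall>x y. \<rho> x y = \<rho> y x) \<and>
     (\<forall>x y z. \<rho> x z \<le> \<rho> x y + \<rho> y z)"

definition intrinsic_metric ::
    "('a \<Rightarrow> 'a \<Rightarrow> real) \<Rightarrow> ('a \<Rightarrow> real) \<Rightarrow> ('a \<Rightarrow> 'a \<Rightarrow> real) \<Rightarrow> bool" where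
  "intrinsic_metric \<mu> m \<rho> \<longleftrightarrow> pseudo_metric \<rho> \<and>
     (\<forall>x. (\<lambda>y. \<mu> x y * (\<rho> x y)\<^sup>2) summable_on UNIV \<and>
          (\<Sum>\<^sub>\<infinity>y. \<mu> x y * (\<rho> x y)\<^sup>2) \<le> m x)"

definition jump_size :: "('a \<Rightarrow> 'a \<Rightarrow> real) \<Rightarrow> ('a \<Rightarrow> 'a \<Rightarrow> real) \<Rightarrow> ennreal" where
  "jump_size \<mu> \<rho> = Sup {ennreal (\<rho> x y) | x y. adjacent \<mu> x y}"

definition weighted_degree :: "('a \<Rightarrow> 'a \<Rightarrow> real) \<Rightarrow> ('a \<Rightarrow> real) \<Rightarrow> 'a \<Rightarrow> real" where
  "weighted_degree \<mu> m x = 1 / m x * (\<Sum>\<^sub>\<infinity>y. \<mu> x y)"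

definition metric_ball :: "('a \<Rightarrow> 'a \<Rightarrow> real) \<Rightarrow> 'a \<Rightarrow> real \<Rightarrow> 'a set" where
  "metric_ball \<rho> x\<^sub>0 r = {x. \<rho> x x\<^sub>0 \<le> r}"

text \<open>The base point \<open>x\<^sub>0\<close> is a parameter; by the triangle inequality its choice is immaterial.\<close>

definition compatible_metric ::
    "('a \<Rightarrow> 'a \<Rightarrow> real) \<Rightarrow> ('a \<Rightarrow> real) \<Rightarrow> 'a \<Rightarrow> ('a \<Rightarrow> 'a \<Rightarrow> real) \<Rightarrow> bool" where
  "compatible_metric \<mu> m x\<^sub>0 \<rho> \<longleftrightarrow> pseudo_metric \<rho> \<and> jump_size \<mu> \<rho> < \<infinity> \<and>
     (\<forall>r\<ge>0. bounded (weighted_degree \<mu> m ` metric_ball \<rho> x\<^sub>0 r))"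

text \<open>
  \<open>vertex_measure m\<close> is the additive extension of \<open>m\<close> to all subsets. Every function is measurable
  for it, so membership in \<open>L\<^sup>p\<close> is integrability of \<open>\<bar>f\<bar>\<^sup>p\<close>; as all vertices have positive
  measure, functions need not be identified almost everywhere.
\<close>

definition vertex_measure :: "('a \<Rightarrow> real) \<Rightarrow> 'a measure" where
  "vertex_measure m = point_measure UNIV (\<lambda>x. ennreal (m x))"

definition Lp_space :: "real \<Rightarrow> ('a \<Rightarrow> real) \<Rightarrow> ('a \<Rightarrow> real) set" where
  "Lp_space p m = {f. integrable (vertex_measure m) (\<lambda>x. \<bar>f x\<bar> powr p)}"

end

theory Submission
  imports Defs
begin

text \<open>
  Put \<open>q = p - 1\<close>. A function \<open>f \<ge> 0\<close> is constant on a connected graph as soon as the energy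
  density \<open>\<mu> x y * (f x - f y) * (f x powr q - f y powr q)\<close>, in which the two differences have the same
  sign, vanishes on every edge. The reason that it vanishes is a Caccioppoli inequality
  (\<open>caccioppoli\<close>): for a cut-off \<open>\<eta>\<close> that is \<open>L\<close>-Lipschitz for the intrinsic metric, the density,
  multiplied by \<open>(\<eta> x)\<^sup>2 + (\<eta> y)\<^sup>2\<close>, is at most a constant times \<open>L\<^sup>2\<close> times the \<open>p\<close>-th power
  of the \<open>L\<^sup>p\<close> norm of \<open>f\<close>. Cut-offs equal to 1 on the ball of radius \<open>R\<close> exist with
  \<open>L = 1 / R\<close>, so letting \<open>R\<close> tend to infinity kills the density on any given edge.

  The Caccioppoli inequality comes from testing \<open>\<Delta> f \<le> 0\<close> against \<open>\<phi> = f powr q * \<eta>\<^sup>2\<close>. Green's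
  formula turns this into the statement that the products \<open>\<mu> x y * (f x - f y) * (\<phi> x - \<phi> y)\<close>
  have a nonpositive sum over all pairs (\<open>subharmonic_test_nonpos\<close>). On the other hand an
  elementary inequality in the values of \<open>f\<close> and \<open>\<eta>\<close> at the two end points
  (\<open>cutoff_product_lower_bound_powr\<close>) bounds each product below by the localised density minus a
  multiple of \<open>\<mu> x y * (f x powr p + f y powr p) * (\<eta> x - \<eta> y)\<^sup>2\<close>. The sum of these error terms is
  what the intrinsic metric controls, because \<open>(\<eta> x - \<eta> y)\<^sup>2 \<le> L\<^sup>2 * (\<rho> x y)\<^sup>2\<close> and the sum of
  \<open>\<mu> x y * (\<rho> x y)\<^sup>2\<close> over \<open>y\<close> is at most \<open>m x\<close>.

  Compatibility of the metric enters through Green's formula: rearranging the double sum requires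
  absolute convergence. The support of \<open>\<eta>\<close> lies in a ball, by finiteness of the jump size its
  neighbours lie in a larger ball, and the weighted degree is bounded there
  (\<open>summable_cutoff_test\<close>). Since balls may be infinite, a cut-off alone would not ensure this.
\<close>

section \<open>Elementary inequalities\<close>

text \<open>For \<open>q \<ge> 1\<close> this is \<open>t powr q \<le> t\<close>; for \<open>q \<le> 1\<close> the graph of the concave
  function \<open>t powr q\<close> lies below its tangent at 1.\<close>

lemma one_minus_le_one_minus_powr:
  fixes t q :: real
  assumes "0 \<le> t" "t \<le> 1" "0 < q"
  shows "1 - t \<le> max 1 (1 / q) * (1 - t powr q)"
proof (cases "t = 0")
  case False
  then have t: "0 < t" using assms by simp
  have nn: "0 \<le> 1 - t powr q" using assms by (simp add: powr_le1)
  show ?thesis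
  proof (cases "q \<le> 1")
    case True
    have "t powr q * 1 powr (1 - q) \<le> q * t + (1 - q) * 1"
      using True assms t by (intro Youngs_inequality_0) auto
    then have "q * (1 - t) \<le> 1 - t powr q" by (simp add: algebra_simps)
    then have "1 - t \<le> (1 / q) * (1 - t powr q)"
      using assms by (simp add: field_simps)
    also have "\<dots> \<le> max 1 (1 / q) * (1 - t powr q)"
      using nn by (intro mult_right_mono) auto
    finally show ?thesis .
  next
    case False
    then have "t powr q \<le> t" using t assms by (intro powr_le_one_le) auto
    then have "1 - t \<le> 1 * (1 - t powr q)" by simp
    also have "\<dots> \<le> max 1 (1 / q) * (1 - t powr q)"
      using nn by (intro mult_right_mono) auto
    finally show ?thesis .
  qed
qed (use assms in simp)

text \<open>
  The preceding inequality at \<open>t = b / a\<close>. It compares \<open>a - b\<close> with the difference of the \<open>q\<close>-th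
  powers, and so allows the gradient of \<open>f\<close> to be absorbed into the energy density.
\<close>

lemma diff_mult_powr_le:
  fixes a b q :: real
  assumes "0 \<le> b" "b \<le> a" "0 < q"
  shows "(a - b) * a powr q \<le> max 1 (1 / q) * (a * (a powr q - b powr q))"
proof (cases "a = 0")
  case False
  then have a: "0 < a" using assms by simp
  have b: "b powr q = (b / a) powr q * a powr q"
    using a assms by (simp flip: powr_mult)
  have "(a - b) * a powr q = (1 - b / a) * (a * a powr q)"
    using a by (simp add: field_simps)
  also have "\<dots> \<le> (max 1 (1 / q) * (1 - (b / a) powr q)) * (a * a powr q)"
    using a assms by (intro mult_right_mono one_minus_le_one_minus_powr) auto
  also have "\<dots> = max 1 (1 / q) * (a * (a powr q - b powr q))"
    unfolding b by (simp add: algebra_simps)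
  finally show ?thesis .
qed simp

text \<open>
  The discrete form of absorbing the derivative of the cut-off. By the product rule the right-hand
  side is \<open>(a - b) * (A - B) * (s\<^sup>2 + t\<^sup>2) / 2\<close> plus a term carrying \<open>s\<^sup>2 - t\<^sup>2 = (s - t) * (s + t)\<close>.
  Young's inequality splits the latter into half of the first term and a multiple of
  \<open>(s - t)\<^sup>2\<close>. The numbers \<open>A\<close> and \<open>B\<close> stand for \<open>q\<close>-th powers of \<open>a\<close> and \<open>b\<close>.
\<close>

lemma cutoff_product_lower_bound:
  fixes a A b B C s t :: real
  assumes ba: "b \<le> a" "0 \<le> B" "B \<le> A" "0 \<le> a" "0 \<le> C" "0 \<le> s" "0 \<le> t"
    and AC: "(a - b) * A \<le> C * (a * (A - B))"
  shows "(a - b) * (A - B) * (s\<^sup>2 + t\<^sup>2) / 4 - 2 * C * (a * A) * (s - t)\<^sup>2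
           \<le> (a - b) * (A * s\<^sup>2 - B * t\<^sup>2)"
proof -
  define d e w where "d = a - b" and "e = d * (A - B)" and "w = \<bar>s - t\<bar> * (s + t)"
  have nn: "0 \<le> d" "0 \<le> e" "0 \<le> w" "0 \<le> A"
    using ba by (auto simp: d_def e_def w_def)
  have "(d * A)\<^sup>2 \<le> (d * A) * (C * (a * (A - B)))"
    unfolding power2_eq_square using AC nn by (intro mult_left_mono) (auto simp: d_def)
  then have dA: "(d * A)\<^sup>2 \<le> C * e * (a * A)"
    by (simp add: e_def algebra_simps)
  have w2: "w\<^sup>2 = (s - t)\<^sup>2 * (s + t)\<^sup>2" by (simp add: w_def power_mult_distrib)
  \<comment> \<open>The two halves of Young's inequality, weighted so that \<open>4 * X * Y\<close> is exactly the bound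
    on \<open>(d * A * w)\<^sup>2\<close> that \<open>dA\<close> gives.\<close>
  define X Y where "X = e * (s + t)\<^sup>2 / 8" and "Y = 2 * C * (a * A) * (s - t)\<^sup>2"
  have XY: "0 \<le> X" "0 \<le> Y" using nn ba by (auto simp: X_def Y_def)
  have "(d * A * w)\<^sup>2 \<le> C * e * (a * A) * w\<^sup>2"
    using dA by (simp add: power_mult_distrib mult_right_mono)
  also have "\<dots> = 4 * X * Y" by (simp add: X_def Y_def w2 algebra_simps)
  also have "\<dots> \<le> (X + Y)\<^sup>2"
    using zero_le_power2[of "X - Y"] by (simp add: power2_eq_square algebra_simps)
  finally have main: "d * A * w \<le> X + Y"
    by (rule power2_le_imp_le) (use XY in simp)
  have "(s + t)\<^sup>2 \<le> 2 * (s\<^sup>2 + t\<^sup>2)"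
    using zero_le_power2[of "s - t"] by (simp add: power2_eq_square algebra_simps)
  then have "e * (s + t)\<^sup>2 \<le> e * (2 * (s\<^sup>2 + t\<^sup>2))"
    using nn by (intro mult_left_mono)
  then have X: "X \<le> e * (s\<^sup>2 + t\<^sup>2) / 4" by (simp add: X_def algebra_simps)
  have "\<bar>s\<^sup>2 - t\<^sup>2\<bar> = w"
  proof -
    have "s\<^sup>2 - t\<^sup>2 = (s - t) * (s + t)" by (simp add: power2_eq_square algebra_simps)
    then show ?thesis using ba by (simp add: w_def abs_mult)
  qed
  then have "- (s\<^sup>2 - t\<^sup>2) \<le> w" by linarith
  then have "d * (A + B) / 2 * (- (s\<^sup>2 - t\<^sup>2)) \<le> d * (A + B) / 2 * w"
    using nn ba by (intro mult_left_mono) auto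
  also have "\<dots> \<le> d * A * w"
    using nn ba by (intro mult_right_mono) (auto simp: algebra_simps mult_right_mono)
  finally have "- (d * (A + B) / 2 * (s\<^sup>2 - t\<^sup>2)) \<le> X + Y" using main by linarith
  moreover have "d * (A * s\<^sup>2 - B * t\<^sup>2)
      = e * (s\<^sup>2 + t\<^sup>2) / 2 + d * (A + B) / 2 * (s\<^sup>2 - t\<^sup>2)"
    by (simp add: e_def field_simps)
  ultimately have "e * (s\<^sup>2 + t\<^sup>2) / 4 - Y \<le> d * (A * s\<^sup>2 - B * t\<^sup>2)"
    using X by linarith
  then show ?thesis by (simp add: d_def e_def Y_def)
qed

text \<open>
  Both sides are symmetric under exchanging the two vertices, so the larger value may be taken
  first. Its \<open>q + 1\<close>-st power is then bounded by the sum of both powers, which is the form that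
  can be summed over pairs.
\<close>

lemma cutoff_product_lower_bound_powr:
  fixes a b q s t :: real
  assumes ab: "0 \<le> a" "0 \<le> b" and q: "0 < q" and st: "0 \<le> s" "0 \<le> t"
  shows "(a - b) * (a powr q - b powr q) * (s\<^sup>2 + t\<^sup>2) / 4
           - 2 * max 1 (1 / q) * (a powr (q + 1) + b powr (q + 1)) * (s - t)\<^sup>2
         \<le> (a - b) * (a powr q * s\<^sup>2 - b powr q * t\<^sup>2)"
    (is "?L a b s t \<le> ?R a b s t")
proof -
  have *: "?L a b s t \<le> ?R a b s t"
    if "0 \<le> b" "b \<le> a" "0 \<le> s" "0 \<le> t" for a b s t :: real
  proof -
    have "(a - b) * (a powr q - b powr q) * (s\<^sup>2 + t\<^sup>2) / 4
            - 2 * max 1 (1 / q) * (a * a powr q) * (s - t)\<^sup>2 \<le> ?R a b s t"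
      using that q diff_mult_powr_le[of b a q]
      by (intro cutoff_product_lower_bound) (auto intro: powr_mono2)
    moreover have "a * a powr q = a powr (q + 1)"
      using that by (cases "a = 0") (auto simp: powr_add)
    moreover have "2 * max 1 (1 / q) * (a powr (q + 1)) * (s - t)\<^sup>2
        \<le> 2 * max 1 (1 / q) * (a powr (q + 1) + b powr (q + 1)) * (s - t)\<^sup>2"
      using q by (intro mult_right_mono mult_left_mono) auto
    ultimately show ?thesis by simp
  qed
  show ?thesis
  proof (cases "b \<le> a")
    case True
    then show ?thesis using * ab st by blast
  next
    case False
    then have "?L b a t s \<le> ?R b a t s" using ab st by (intro *) auto
    then show ?thesis by (simp add: algebra_simps power2_commute)
  qed
qed

section \<open>Sums over pairs of vertices\<close>

text \<open>
  Tonelli's theorem, used with \<open>k = \<mu>\<close> on a set of bounded degree to obtain absolute convergence,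
  and with \<open>k x y = \<mu> x y * (\<rho> x y)\<^sup>2\<close> to bound the error terms.
\<close>

lemma has_sum_symmetric_kernel:
  fixes k :: "'a \<Rightarrow> 'a \<Rightarrow> real" and g :: "'a \<Rightarrow> real"
  assumes k: "\<And>x y. 0 \<le> k x y" "\<And>x y. k x y = k y x" "\<And>x. k x summable_on UNIV"
    and g: "\<And>x. 0 \<le> g x" "(\<lambda>x. (\<Sum>\<^sub>\<infinity>y. k x y) * g x) summable_on UNIV"
  shows "((\<lambda>(x, y). k x y * (g x + g y)) has_sum (2 * (\<Sum>\<^sub>\<infinity>x. (\<Sum>\<^sub>\<infinity>y. k x y) * g x))) UNIV"
proof -
  let ?S = "\<Sum>\<^sub>\<infinity>x. (\<Sum>\<^sub>\<infinity>y. k x y) * g x"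
  have inner: "((\<lambda>y. case (x, y) of (x, y) \<Rightarrow> k x y * g x) has_sum (\<Sum>\<^sub>\<infinity>y. k x y) * g x) UNIV" for x
    using has_sum_cmult_left[OF has_sum_infsum[OF k(3)[of x]], of "g x"] by simp
  have "((\<lambda>(x, y). k x y * g x) has_sum ?S) (UNIV \<times> UNIV)"
    by (intro has_sum_SigmaI[OF inner] summable_on_SigmaI[OF inner] has_sum_infsum g)
       (auto simp: k g)
  moreover from this have "((\<lambda>(x, y). k x y * g y) has_sum ?S) (UNIV \<times> UNIV)"
    using has_sum_swap[of "\<lambda>(x, y). k x y * g x" UNIV UNIV ?S] k(2)
    by (simp add: case_prod_unfold)
  ultimately have "((\<lambda>z. (case z of (x, y) \<Rightarrow> k x y * g x) + (case z of (x, y) \<Rightarrow> k x y * g y))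
      has_sum (?S + ?S)) (UNIV \<times> UNIV)"
    by (rule has_sum_add)
  then show ?thesis by (simp add: case_prod_unfold algebra_simps)
qed

lemma summable_on_Lp_space:
  assumes "\<And>x. 0 \<le> m x" "f \<in> Lp_space p m"
  shows "(\<lambda>x. m x * \<bar>f x\<bar> powr p) summable_on UNIV"
proof -
  have "integrable (count_space UNIV) (\<lambda>x. m x *\<^sub>R \<bar>f x\<bar> powr p)"
    using assms unfolding Lp_space_def vertex_measure_def point_measure_def
    by (subst (asm) mem_Collect_eq, subst (asm) integrable_density) auto
  then have "Infinite_Sum.abs_summable_on (\<lambda>x. m x *\<^sub>R \<bar>f x\<bar> powr p) UNIV"
    unfolding abs_summable_equivalent abs_summable_on_def .
  then show ?thesis using abs_summable_summable by fastforce
qed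

context weighted_graph
begin

text \<open>
  Green's formula. Summing \<open>\<mu> x y * \<phi> x * (f x - f y)\<close> over \<open>y\<close> first gives
  \<open>\<phi> x * m x * \<Delta> f x \<le> 0\<close>; adding the sum with \<open>x\<close> and \<open>y\<close> exchanged produces the difference
  of \<open>\<phi>\<close>.
\<close>

lemma subharmonic_test_nonpos:
  assumes f: "\<And>x. 0 \<le> f x" "subharmonic \<mu> m f" and \<phi>: "\<And>x. 0 \<le> \<phi> x"
    and summable: "(\<lambda>(x, y). \<mu> x y * \<phi> x * (f x - f y)) summable_on UNIV"
  obtains S where "S \<le> 0"
    and "((\<lambda>(x, y). \<mu> x y * ((f x - f y) * (\<phi> x - \<phi> y))) has_sum S) UNIV"
proof -
  let ?T = "\<lambda>(x, y). \<mu> x y * \<phi> x * (f x - f y)"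
  obtain S where S: "(?T has_sum S) (UNIV \<times> UNIV)"
    using summable by (auto simp: summable_on_def)
  have inner: "((\<lambda>y. ?T (x, y)) has_sum (\<phi> x * (m x * laplacian \<mu> m f x))) UNIV" for x
  proof -
    have "(\<lambda>y. \<mu> x y * f y) summable_on UNIV"
      using f by (simp add: subharmonic_def F_space_def)
    then have "(\<lambda>y. \<mu> x y * f x + - (\<mu> x y * f y)) summable_on UNIV"
      by (intro summable_on_add summable_on_cmult_left \<mu>_summable)
         (simp add: summable_on_uminus)
    then have "(\<lambda>y. \<mu> x y * (f x - f y)) summable_on UNIV"
      by (simp add: algebra_simps)
    from has_sum_cmult_right[OF has_sum_infsum[OF this], of "\<phi> x"]
    show ?thesis using m_pos[of x] by (simp add: laplacian_def mult_ac)
  qed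
  have "((\<lambda>x. \<phi> x * (m x * laplacian \<mu> m f x)) has_sum S) UNIV"
    by (rule has_sum_SigmaD[OF S inner])
  moreover have "((\<lambda>x. 0::real) has_sum 0) (UNIV :: 'a set)" by simp
  moreover have "\<phi> x * (m x * laplacian \<mu> m f x) \<le> 0" for x
    using f(2) \<phi>[of x] m_pos[of x]
    by (intro mult_nonneg_nonpos) (auto simp: subharmonic_def less_imp_le)
  ultimately have "S \<le> 0" by (rule has_sum_mono)
  have "((\<lambda>(x, y). ?T (y, x)) has_sum S) (UNIV \<times> UNIV)"
    using S has_sum_swap[of ?T UNIV UNIV S] by simp
  from has_sum_add[OF S this]
  have "((\<lambda>(x, y). \<mu> x y * ((f x - f y) * (\<phi> x - \<phi> y))) has_sum (S + S)) UNIV"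
    by (simp add: case_prod_unfold \<mu>_sym algebra_simps)
  with \<open>S \<le> 0\<close> show ?thesis by (intro that[of "S + S"]) auto
qed

text \<open>
  A nonzero term has both vertices in \<open>U\<close>, where it is dominated by
  \<open>\<mu> x y * (f x powr (q + 1) + f y powr (q + 1))\<close>. Since the degree is bounded on \<open>U\<close>, Tonelli
  reduces the sum of these to that of \<open>m x * f x powr (q + 1)\<close>.
\<close>

lemma summable_cutoff_test:
  assumes f: "\<And>x. 0 \<le> f x" and q: "0 < q"
    and Lp: "(\<lambda>x. m x * f x powr (q + 1)) summable_on UNIV"
    and \<eta>: "\<And>x. 0 \<le> \<eta> x" "\<And>x. \<eta> x \<le> 1"
    and U: "\<And>x y. \<eta> x \<noteq> 0 \<Longrightarrow> 0 < \<mu> x y \<Longrightarrow> x \<in> U \<and> y \<in> U"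
    and K: "\<And>x. x \<in> U \<Longrightarrow> weighted_degree \<mu> m x \<le> K"
  shows "(\<lambda>(x, y). \<mu> x y * (f x powr q * (\<eta> x)\<^sup>2) * (f x - f y)) summable_on UNIV"
proof -
  define g where "g x = (if x \<in> U then f x powr (q + 1) else 0)" for x
  have g: "0 \<le> g x" for x by (simp add: g_def)
  have deg: "(\<Sum>\<^sub>\<infinity>y. \<mu> x y) = m x * weighted_degree \<mu> m x" for x
    using m_pos[of x] by (simp add: weighted_degree_def)
  have deg0: "0 \<le> (\<Sum>\<^sub>\<infinity>y. \<mu> x y)" for x
    by (intro infsum_nonneg \<mu>_nonneg)
  have "(\<lambda>x. (\<Sum>\<^sub>\<infinity>y. \<mu> x y) * g x) summable_on UNIV"
  proof (rule summable_on_comparison_test)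
    show "(\<lambda>x. \<bar>K\<bar> * (m x * f x powr (q + 1))) summable_on UNIV"
      by (intro summable_on_cmult_right Lp)
    show "0 \<le> (\<Sum>\<^sub>\<infinity>y. \<mu> x y) * g x" for x
      using g deg0 by simp
    show "(\<Sum>\<^sub>\<infinity>y. \<mu> x y) * g x \<le> \<bar>K\<bar> * (m x * f x powr (q + 1))" for x
    proof (cases "x \<in> U")
      case True
      have "m x * weighted_degree \<mu> m x * g x \<le> m x * \<bar>K\<bar> * g x"
        using m_pos[of x] g K[OF True] by (intro mult_right_mono mult_left_mono) auto
      then show ?thesis using True by (simp add: deg g_def mult_ac)
    next
      case False
      then show ?thesis using m_pos[of x] by (simp add: g_def)
    qed
  qed
  from has_sum_symmetric_kernel[OF \<mu>_nonneg \<mu>_sym \<mu>_summable g this]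
  have sum: "(\<lambda>(x, y). \<mu> x y * (g x + g y)) summable_on UNIV"
    by (auto simp: summable_on_def)
  have "\<bar>\<mu> x y * (f x powr q * (\<eta> x)\<^sup>2) * (f x - f y)\<bar> \<le> \<mu> x y * (g x + g y)" for x y
  proof (cases "\<eta> x \<noteq> 0 \<and> 0 < \<mu> x y")
    case True
    then have xy: "x \<in> U" "y \<in> U" using U by blast+
    define M where "M = max (f x) (f y)"
    have M: "0 \<le> M" "f x \<le> M" "\<bar>f x - f y\<bar> \<le> M" 
      using f[of x] f[of y] by (auto simp: M_def)
    have "(\<eta> x)\<^sup>2 \<le> 1" using \<eta> by (simp add: power_le_one)
    then have "f x powr q * (\<eta> x)\<^sup>2 * \<bar>f x - f y\<bar> \<le> M powr q * 1 * M"
      using M f[of x] q by (intro mult_mono powr_mono2) auto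
    also have "\<dots> = M powr (q + 1)"
      using M by (cases "M = 0") (auto simp: powr_add)
    also have "\<dots> \<le> g x + g y" using xy by (auto simp: g_def M_def max_def)
    finally show ?thesis using \<mu>_nonneg[of x y]
      by (simp add: abs_mult mult.assoc mult_left_mono)
  next
    case False
    then show ?thesis using \<mu>_nonneg[of x y] g[of x] g[of y] by auto
  qed
  then have "Infinite_Sum.abs_summable_on
      (\<lambda>(x, y). \<mu> x y * (f x powr q * (\<eta> x)\<^sup>2) * (f x - f y)) UNIV"
    by (intro Infinite_Sum.abs_summable_on_comparison_test'[OF sum]) auto
  then show ?thesis by (rule abs_summable_summable)
qed

text \<open>
  The inequality holds for the sum of the left-hand sides over all pairs; since they are
  nonnegative, it holds for each of them, and for a fixed pair the limit \<open>L \<rightarrow> 0\<close> can be taken.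
\<close>

lemma caccioppoli:
  assumes f: "\<And>x. 0 \<le> f x" "subharmonic \<mu> m f" and q: "0 < q"
    and Lp: "(\<lambda>x. m x * f x powr (q + 1)) summable_on UNIV"
    and \<eta>: "\<And>x. 0 \<le> \<eta> x" "\<And>x. \<eta> x \<le> 1"
    and U: "\<And>x y. \<eta> x \<noteq> 0 \<Longrightarrow> 0 < \<mu> x y \<Longrightarrow> x \<in> U \<and> y \<in> U"
    and K: "\<And>x. x \<in> U \<Longrightarrow> weighted_degree \<mu> m x \<le> K"
    and \<rho>: "intrinsic_metric \<mu> m \<rho>" and lip: "\<And>x y. \<bar>\<eta> x - \<eta> y\<bar> \<le> L * \<rho> x y"
  shows "\<mu> x y * ((f x - f y) * (f x powr q - f y powr q) * ((\<eta> x)\<^sup>2 + (\<eta> y)\<^sup>2))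
           \<le> 16 * max 1 (1 / q) * L\<^sup>2 * (\<Sum>\<^sub>\<infinity>x. m x * f x powr (q + 1))"
proof -
  define C where "C = max 1 (1 / q)"
  define N where "N = (\<Sum>\<^sub>\<infinity>x. m x * f x powr (q + 1))"
  define h where "h x = f x powr (q + 1)" for x
  define k where "k x y = \<mu> x y * (\<rho> x y)\<^sup>2" for x y
  define \<phi> where "\<phi> x = f x powr q * (\<eta> x)\<^sup>2" for x
  define E where "E x y = \<mu> x y * ((f x - f y) * (f x powr q - f y powr q) * ((\<eta> x)\<^sup>2 + (\<eta> y)\<^sup>2)) / 4"
    for x y
  \<comment> \<open>\<open>E\<close> is the main term of the pointwise bound; \<open>G\<close>, the tested product with the error term
    added back, dominates it and has a computable sum.\<close>
  define G where "G z = (case z of (x, y) \<Rightarrow> \<mu> x y * ((f x - f y) * (\<phi> x - \<phi> y))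
      + 2 * C * L\<^sup>2 * (k x y * (h x + h y)))" for z
  have C: "0 \<le> C" by (simp add: C_def)
  obtain S where S: "S \<le> 0" "((\<lambda>(x, y). \<mu> x y * ((f x - f y) * (\<phi> x - \<phi> y))) has_sum S) UNIV"
    using subharmonic_test_nonpos[OF f, of \<phi>] summable_cutoff_test[OF f(1) q Lp \<eta> U K]
    unfolding \<phi>_def by auto
  have k: "0 \<le> k x y" "k x y = k y x" "k x summable_on UNIV" "(\<Sum>\<^sub>\<infinity>y. k x y) \<le> m x" for x y
    using \<rho> \<mu>_nonneg[of x y] \<mu>_sym[of x y]
    by (auto simp: k_def[abs_def] intrinsic_metric_def pseudo_metric_def)
  have k0: "0 \<le> (\<Sum>\<^sub>\<infinity>y. k x y)" for x by (intro infsum_nonneg k)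
  have h: "0 \<le> h x" for x by (simp add: h_def)
  have kh: "(\<Sum>\<^sub>\<infinity>y. k x y) * h x \<le> m x * h x" for x
    using k(4)[of x] h by (intro mult_right_mono)
  have sum_kh: "(\<lambda>x. (\<Sum>\<^sub>\<infinity>y. k x y) * h x) summable_on UNIV"
    using k0 h kh Lp[folded h_def] by (intro summable_on_comparison_test[OF Lp[folded h_def]]) auto
  have le_N: "(\<Sum>\<^sub>\<infinity>x. (\<Sum>\<^sub>\<infinity>y. k x y) * h x) \<le> N"
    unfolding N_def h_def[symmetric] using kh Lp[folded h_def]
    by (intro infsum_mono sum_kh) auto
  have "(G has_sum (S + 2 * C * L\<^sup>2 * (2 * (\<Sum>\<^sub>\<infinity>x. (\<Sum>\<^sub>\<infinity>y. k x y) * h x)))) UNIV"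
    using has_sum_add[OF S(2) has_sum_cmult_right[OF
        has_sum_symmetric_kernel[OF k(1-3) h sum_kh], of "2 * C * L\<^sup>2"]]
    by (simp add: G_def[abs_def] case_prod_unfold)
  moreover have EG: "E x y \<le> G (x, y)" for x y
  proof -
    have "(\<eta> x - \<eta> y)\<^sup>2 \<le> (L * \<rho> x y)\<^sup>2"
      using power_mono[OF lip[of x y], of 2] by simp
    then have "2 * C * (h x + h y) * (\<eta> x - \<eta> y)\<^sup>2 \<le> 2 * C * (h x + h y) * (L * \<rho> x y)\<^sup>2"
      using C h[of x] h[of y] by (intro mult_left_mono) auto
    with cutoff_product_lower_bound_powr[OF f(1)[of x] f(1)[of y] q \<eta>(1)[of x] \<eta>(1)[of y]]
    have "(f x - f y) * (f x powr q - f y powr q) * ((\<eta> x)\<^sup>2 + (\<eta> y)\<^sup>2) / 4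
        \<le> (f x - f y) * (\<phi> x - \<phi> y) + 2 * C * (h x + h y) * (L * \<rho> x y)\<^sup>2"
      by (simp add: C_def h_def \<phi>_def)
    from mult_left_mono[OF this \<mu>_nonneg[of x y]]
    show ?thesis by (simp add: E_def G_def k_def power_mult_distrib algebra_simps)
  qed
  moreover have "0 \<le> E x y" for x y
  proof -
    have "0 \<le> (f x - f y) * (f x powr q - f y powr q)"
      using f(1)[of x] f(1)[of y] q
        powr_mono2[of q "f x" "f y"] powr_mono2[of q "f y" "f x"]
      by (cases "f x \<le> f y") (auto intro: mult_nonneg_nonneg mult_nonpos_nonpos)
    then show ?thesis using \<mu>_nonneg by (simp add: E_def)
  qed
  then have G0: "0 \<le> G z" for z using EG by (cases z) (meson order_trans)
  ultimately have "sum G {(x, y)} \<le> S + 2 * C * L\<^sup>2 * (2 * (\<Sum>\<^sub>\<infinity>x. (\<Sum>\<^sub>\<infinity>y. k x y) * h x))"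
    by (intro finite_sum_le_has_sum) auto
  also have "\<dots> \<le> 0 + 2 * C * L\<^sup>2 * (2 * N)"
    using S(1) le_N C by (intro add_mono mult_left_mono) auto
  finally have "E x y \<le> 4 * C * L\<^sup>2 * N" using EG[of x y] by simp
  then show ?thesis by (simp add: E_def C_def N_def)
qed

end

section \<open>Cut-off functions and the Liouville property\<close>

lemma adjacent_le_jump_size:
  assumes "jump_size \<mu> \<rho> < \<infinity>" "0 < \<mu> x y"
  shows "\<rho> x y \<le> enn2real (jump_size \<mu> \<rho>)"
proof -
  have "ennreal (\<rho> x y) \<le> jump_size \<mu> \<rho>"
    unfolding jump_size_def using assms(2) by (intro Sup_upper) (auto simp: adjacent_def)
  also have "\<dots> = ennreal (enn2real (jump_size \<mu> \<rho>))"
    using assms(1) by simp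
  finally show ?thesis by (simp add: ennreal_le_iff)
qed

text \<open>
  The cut-off decreases linearly in the distance from the centre, between the radii \<open>R\<close> and
  \<open>2 * R\<close>.
\<close>

lemma metric_cutoff:
  assumes \<rho>: "pseudo_metric \<rho>" and R: "0 < R"
  obtains \<eta> :: "'a \<Rightarrow> real" where "\<And>x. 0 \<le> \<eta> x" "\<And>x. \<eta> x \<le> 1"
    "\<And>x. \<rho> x o' \<le> R \<Longrightarrow> \<eta> x = 1" "\<And>x. \<eta> x \<noteq> 0 \<Longrightarrow> \<rho> x o' \<le> 2 * R"
    "\<And>x y. \<bar>\<eta> x - \<eta> y\<bar> \<le> 1 / R * \<rho> x y"
proof -
  define \<eta> where "\<eta> x = max 0 (min 1 (2 - \<rho> x o' / R))" for x
  show ?thesis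
  proof
    show "\<eta> x = 1" if "\<rho> x o' \<le> R" for x using that R by (simp add: \<eta>_def field_simps)
    show "\<rho> x o' \<le> 2 * R" if "\<eta> x \<noteq> 0" for x
      using that R by (auto simp: \<eta>_def max_def min_def field_simps split: if_splits)
    show "\<bar>\<eta> x - \<eta> y\<bar> \<le> 1 / R * \<rho> x y" for x y
    proof -
      have "\<rho> x o' \<le> \<rho> x y + \<rho> y o'" "\<rho> y o' \<le> \<rho> x y + \<rho> x o'"
        using \<rho> unfolding pseudo_metric_def by metis+
      then have "\<bar>\<rho> x o' - \<rho> y o'\<bar> / R \<le> \<rho> x y / R"
        using R by (intro divide_right_mono) auto
      moreover have "\<bar>\<eta> x - \<eta> y\<bar> \<le> \<bar>\<rho> x o' / R - \<rho> y o' / R\<bar>"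
        unfolding \<eta>_def by linarith
      ultimately show ?thesis using R by (simp flip: diff_divide_distrib)
    qed
  qed (auto simp: \<eta>_def)
qed

text \<open>
  The Caccioppoli inequality for the cut-offs at radius \<open>R\<close>, with both end points of the edge inside
  the ball of radius \<open>R\<close>, as \<open>R\<close> tends to infinity. Since \<open>f powr q\<close> is strictly increasing in
  \<open>f\<close>, the energy density of an edge vanishes only if the two values of \<open>f\<close> coincide.
\<close>

lemma (in weighted_graph) subharmonic_Lp_eq_on_edge:
  assumes f: "\<And>x. 0 \<le> f x" "subharmonic \<mu> m f" and q: "0 < q"
    and Lp: "(\<lambda>x. m x * f x powr (q + 1)) summable_on UNIV"
    and \<rho>: "intrinsic_metric \<mu> m \<rho>" "compatible_metric \<mu> m x\<^sub>0 \<rho>"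
    and xy: "0 < \<mu> x y"
  shows "f x = f y"
proof -
  define e where "e = \<mu> x y * ((f x - f y) * (f x powr q - f y powr q) * 2)"
  define N where "N = (\<Sum>\<^sub>\<infinity>x. m x * f x powr (q + 1))"
  define s where "s = enn2real (jump_size \<mu> \<rho>)"
  define R\<^sub>0 where "R\<^sub>0 = \<rho> x x\<^sub>0 + \<rho> y x\<^sub>0 + 1"
  have pm: "pseudo_metric \<rho>" using \<rho> by (simp add: intrinsic_metric_def)
  have nn: "0 \<le> \<rho> a b" for a b using pm by (simp add: pseudo_metric_def)
  have s: "0 \<le> s" "0 < \<mu> a b \<Longrightarrow> \<rho> a b \<le> s" for a b
    using \<rho>(2) adjacent_le_jump_size[of \<mu> \<rho> a b] by (auto simp: s_def compatible_metric_def)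
  have bound: "e \<le> 16 * max 1 (1 / q) * N * (1 / R)\<^sup>2" if R: "R\<^sub>0 \<le> R" for R
  proof -
    have R0: "0 < R" "\<rho> x x\<^sub>0 \<le> R" "\<rho> y x\<^sub>0 \<le> R"
      using R nn[of x x\<^sub>0] nn[of y x\<^sub>0] by (auto simp: R\<^sub>0_def)
    \<comment> \<open>The ball supporting the cut-off, enlarged by the jump size so as to contain all
      neighbours.\<close>
    define U where "U = metric_ball \<rho> x\<^sub>0 (2 * R + s)"
    obtain \<eta> :: "'a \<Rightarrow> real" where \<eta>: "\<And>x. 0 \<le> \<eta> x" "\<And>x. \<eta> x \<le> 1"
      "\<And>x. \<rho> x x\<^sub>0 \<le> R \<Longrightarrow> \<eta> x = 1" "\<And>x. \<eta> x \<noteq> 0 \<Longrightarrow> \<rho> x x\<^sub>0 \<le> 2 * R"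
      "\<And>x y. \<bar>\<eta> x - \<eta> y\<bar> \<le> 1 / R * \<rho> x y"
      using metric_cutoff[OF pm R0(1)] by metis
    have "bounded (weighted_degree \<mu> m ` U)"
      using \<rho>(2) R0 s by (simp add: compatible_metric_def U_def)
    then obtain K where K: "\<And>x. x \<in> U \<Longrightarrow> weighted_degree \<mu> m x \<le> K"
      unfolding bounded_iff by (metis image_eqI abs_le_D1 real_norm_def)
    have U: "a \<in> U \<and> b \<in> U" if "\<eta> a \<noteq> 0" "0 < \<mu> a b" for a b
    proof -
      have "\<rho> b x\<^sub>0 \<le> \<rho> a b + \<rho> a x\<^sub>0"
        using pm unfolding pseudo_metric_def by metis
      then show ?thesis
        using \<eta>(4)[OF that(1)] s(1) s(2)[OF that(2)] by (simp add: U_def metric_ball_def)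
    qed
    have "e = \<mu> x y * ((f x - f y) * (f x powr q - f y powr q) * ((\<eta> x)\<^sup>2 + (\<eta> y)\<^sup>2))"
      using \<eta>(3) R0 by (simp add: e_def)
    also have "\<dots> \<le> 16 * max 1 (1 / q) * (1 / R)\<^sup>2 * N"
      unfolding N_def by (rule caccioppoli[OF f q Lp \<eta>(1,2) U K \<rho>(1) \<eta>(5)])
    finally show ?thesis by (simp add: mult_ac)
  qed
  have "((\<lambda>R. 16 * max 1 (1 / q) * N * (1 / R)\<^sup>2) \<longlongrightarrow> 16 * max 1 (1 / q) * N * 0\<^sup>2) at_top"
    by (intro tendsto_intros tendsto_divide_0[OF tendsto_const] filterlim_ident
          filterlim_at_top_imp_at_infinity)
  moreover have "\<forall>\<^sub>F R in at_top. e \<le> 16 * max 1 (1 / q) * N * (1 / R)\<^sup>2"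
    using bound by (auto simp: eventually_at_top_linorder)
  ultimately have "e \<le> 16 * max 1 (1 / q) * N * 0\<^sup>2"
    by (intro tendsto_lowerbound) auto
  then have e: "(f x - f y) * (f x powr q - f y powr q) \<le> 0"
    using xy by (simp add: e_def mult_le_0_iff)
  show ?thesis
  proof (rule ccontr)
    assume "f x \<noteq> f y"
    then have "0 < (f x - f y) * (f x powr q - f y powr q)"
      using f(1) q powr_less_mono2[of q "f x" "f y"] powr_less_mono2[of q "f y" "f x"]
      by (cases "f x < f y") (auto intro!: mult_pos_pos mult_neg_neg)
    with e show False by simp
  qed
qed

theorem corollary1p2:
  fixes \<mu> :: "'a::countable \<Rightarrow> 'a \<Rightarrow> real" and m :: "'a \<Rightarrow> real" and x\<^sub>0 :: 'a
    and p :: real and f :: "'a \<Rightarrow> real"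
  assumes "weighted_graph \<mu> m"
    and "graph_connected \<mu>"
    and "\<exists>\<rho>. intrinsic_metric \<mu> m \<rho> \<and> compatible_metric \<mu> m x\<^sub>0 \<rho>"
    and "1 < p"
    and "\<forall>x. f x \<ge> 0"
    and "subharmonic \<mu> m f"
    and "f \<in> Lp_space p m"
  shows "f constant_on UNIV"
proof -
  interpret weighted_graph \<mu> m by fact
  obtain \<rho> where \<rho>: "intrinsic_metric \<mu> m \<rho>" "compatible_metric \<mu> m x\<^sub>0 \<rho>"
    using assms(3) by blast
  have "(\<lambda>x. m x * \<bar>f x\<bar> powr p) summable_on UNIV"
    using assms(7) m_pos by (intro summable_on_Lp_space) (auto intro: less_imp_le)
  then have Lp: "(\<lambda>x. m x * f x powr (p - 1 + 1)) summable_on UNIV"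
    using assms(5) by simp
  have edge: "f x = f y" if "adjacent \<mu> x y" for x y
    using subharmonic_Lp_eq_on_edge[OF _ assms(6) _ Lp \<rho>] that assms(4,5)
    by (simp add: adjacent_def)
  have "f x\<^sub>0 = f x" for x
  proof -
    have "(adjacent \<mu>)\<^sup>*\<^sup>* x\<^sub>0 x" using assms(2) by (simp add: graph_connected_def)
    then show ?thesis by induction (auto dest: edge)
  qed
  then show ?thesis unfolding constant_on_def by metis
qed

end
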